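(* Let $(\lambda_n)_{n\ge1}$ be any sequence in $\mathbb C\setminus\{0\}$, and let $\underline a=(a_n)_{n\ge1}$, $\underline b=(b_n)_{n\ge1}$ be sequences with $0<a_n<b_n$ for all $n$. Suppose that $\inf_{n\in\mathbb N} a_n>0$ and \[ \liminf_{n\to\infty}\left(\frac{\Delta_{n+1}}{a_1\cdots a_n}\right)^{1/n}=0, \] where $\Delta_n=\log(b_n/a_n)$. Then $\dim_H I_{\underline a}^{\underline b}(E_{\underline\lambda})\le 1$.
   Context: For $\lambda\in\mathbb C\setminus\{0\}$ let $E_\lambda(z)=\lambda e^z$. For $\underline\lambda=(\lambda_n)_{n\ge1}$ and sequences $\underline a,\underline b$ with $0<a_n<b_n$, \[ I_{\underline a}^{\underline b}(E_{\underline\lambda})=\{z\in\mathbb C:\ a_n\le |E_{\lambda_n}\circ\cdots\circ E_{\lambda_1}(z)|\le b_n \text{ for every sufficiently large } n\in\mathbb N\}. \] $\dim_H$ denotes Hausdorff dimension. *)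

theory Defs
  imports "HOL-Analysis.Analysis"
begin

text \<open>Iterated composition E_{lambda_n} o ... o E_{lambda_1}, sequences indexed from 1.\<close>
fun exp_iter :: "(nat \<Rightarrow> complex) \<Rightarrow> nat \<Rightarrow> complex \<Rightarrow> complex" where
  "exp_iter lam 0 z = z"
| "exp_iter lam (Suc n) z = lam (Suc n) * exp (exp_iter lam n z)"

definition I_set :: "(nat \<Rightarrow> complex) \<Rightarrow> (nat \<Rightarrow> real) \<Rightarrow> (nat \<Rightarrow> real) \<Rightarrow> complex set" where
  "I_set lam a b = {z. \<forall>\<^sub>F n in sequentially. a n \<le> cmod (exp_iter lam n z) \<and> cmod (exp_iter lam n z) \<le> b n}"

definition hausdorff_pre :: "real \<Rightarrow> real \<Rightarrow> 'a::metric_space set \<Rightarrow> ennreal" where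
  "hausdorff_pre s \<delta> A =
     (INF U \<in> {U :: nat \<Rightarrow> 'a set. A \<subseteq> (\<Union>i. U i) \<and> (\<forall>i. bounded (U i) \<and> diameter (U i) \<le> \<delta>)}.
        (\<Sum>i. ennreal (diameter (U i) powr s)))"

definition hausdorff_measure :: "real \<Rightarrow> 'a::metric_space set \<Rightarrow> ennreal" where
  "hausdorff_measure s A = (SUP \<delta> \<in> {0<..}. hausdorff_pre s \<delta> A)"

definition hausdorff_dim :: "'a::metric_space set \<Rightarrow> ereal" where
  "hausdorff_dim A = (INF s \<in> {s::real. 0 < s \<and> hausdorff_measure s A = 0}. ereal s)"

end

theory Submission
  imports Defs
begin

text \<open>
  Let \<open>F n\<close> be the \<open>n\<close>-th iterate and \<open>s = 1 + e > 1\<close>. A point of the set has \<open>F n\<close> in a vertical strip of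
  width \<open>\<Delta> (n + 1)\<close>, which is covered by small pieces and pulled back under the branches of the
  logarithm. A piece of diameter \<open>d\<close> near \<open>w\<close> has preimages of diameter about \<open>d / \<bar>w\<bar>\<close>, spaced \<open>2 \<pi>\<close> apart
  on a vertical line; as the preimages \<open>u\<close> of interest satisfy \<open>\<bar>u\<bar> \<ge> a\<close>, the series of \<open>\<bar>u\<bar> powr - s\<close> over
  them is \<open>O(a powr - e)\<close>. Thus \<open>n\<close> steps cost a factor \<open>K ^ n * (a 1 \<cdots> a n) powr - e\<close>, and
  covering the strip costs \<open>\<Delta> (n + 1) powr e\<close>. The product tends to 0 along a subsequence by the
  assumption on the lower limit. If \<open>a\<close> is small, pieces may expand under a pullback; they are then
  cut into boundedly many smaller ones, which only affects \<open>K\<close>.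
\<close>

section \<open>Hausdorff content: subadditivity and the link to dimension\<close>

text \<open>There is no bound on the diameters here: the content vanishes if and only if the measure
  does, since a cover with a small sum consists of small sets.\<close>
definition hausdorff_content :: "real \<Rightarrow> 'a::metric_space set \<Rightarrow> ennreal" where
  "hausdorff_content s A =
     (INF U \<in> {U :: nat \<Rightarrow> 'a set. A \<subseteq> (\<Union>i. U i) \<and> (\<forall>i. bounded (U i))}.
        (\<Sum>i. ennreal (diameter (U i) powr s)))"

lemma hausdorff_content_le_suminf:
  assumes "A \<subseteq> (\<Union>i. U i)" "\<And>i. bounded (U i)"
  shows "hausdorff_content s A \<le> (\<Sum>i. ennreal (diameter (U i) powr s))"
  unfolding hausdorff_content_def by (rule INF_lower) (use assms in auto)

lemma hausdorff_content_mono: "A \<subseteq> B \<Longrightarrow> hausdorff_content s A \<le> hausdorff_content s B"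
  unfolding hausdorff_content_def by (rule INF_superset_mono) auto

lemma hausdorff_content_le_diameter:
  assumes "bounded A"
  shows "hausdorff_content s A \<le> ennreal (diameter A powr s)"
proof -
  define U where "U = (\<lambda>i::nat. if i = 0 then A else {})"
  have "hausdorff_content s A \<le> (\<Sum>i. ennreal (diameter (U i) powr s))"
    by (rule hausdorff_content_le_suminf) (use assms in \<open>auto simp: U_def\<close>)
  also have "\<dots> = (\<Sum>i\<in>{0}. ennreal (diameter (U i) powr s))"
    by (rule suminf_finite) (auto simp: U_def diameter_empty)
  finally show ?thesis by (simp add: U_def)
qed

lemma hausdorff_content_empty [simp]: "hausdorff_content s {} = 0"
  using hausdorff_content_le_diameter[of "{}" s] by (simp add: diameter_empty)

lemma hausdorff_content_singleton [simp]: "hausdorff_content s {x} = 0"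
  using hausdorff_content_le_diameter[of "{x}" s] by (simp add: diameter_singleton)

lemma ennreal_le_suminf: "f i \<le> (\<Sum>i. f i)" for f :: "nat \<Rightarrow> ennreal"
  using sum_le_suminf[of f "{i}"] by simp

text \<open>Covers of the \<open>A i\<close> that are optimal up to \<open>e * (1/2) ^ Suc i\<close>
  are merged into one sequence through \<open>prod_decode\<close>; the errors add up to
  \<open>e\<close>.\<close>

lemma hausdorff_content_UN_le:
  fixes A :: "nat \<Rightarrow> 'a::metric_space set"
  shows "hausdorff_content s (\<Union>i. A i) \<le> (\<Sum>i. hausdorff_content s (A i))"
proof (rule ennreal_le_epsilon)
  fix e :: real
  assume e: "0 < e" and fin: "(\<Sum>i. hausdorff_content s (A i)) < top"
  have "\<exists>U. A i \<subseteq> (\<Union>j. U j) \<and> (\<forall>j. bounded (U j)) \<and>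
      (\<Sum>j. ennreal (diameter (U j) powr s)) \<le> hausdorff_content s (A i) + ennreal (e * (1/2) ^ Suc i)" for i
  proof -
    have "hausdorff_content s (A i) \<le> (\<Sum>i. hausdorff_content s (A i))"
      by (rule ennreal_le_suminf)
    then have "hausdorff_content s (A i) < top"
      using fin by (rule le_less_trans)
    then have lt: "hausdorff_content s (A i) < hausdorff_content s (A i) + ennreal (e * (1/2) ^ Suc i)"
      using e fin by (simp add: ennreal_add_left_cancel_less)
    then show ?thesis
      unfolding hausdorff_content_def[of s "A i"] INF_less_iff
      by (auto intro: less_imp_le)
  qed
  then obtain U where U: "\<And>i. A i \<subseteq> (\<Union>j. U i j)" "\<And>i j. bounded (U i j)"
    "\<And>i. (\<Sum>j. ennreal (diameter (U i j) powr s)) \<le> hausdorff_content s (A i) + ennreal (e * (1/2) ^ Suc i)"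
    by metis
  define V where "V = (\<lambda>n. case prod_decode n of (i, j) \<Rightarrow> U i j)"
  have cov: "(\<Union>i. A i) \<subseteq> (\<Union>n. V n)"
  proof
    fix x assume "x \<in> (\<Union>i. A i)"
    then obtain i j where "x \<in> U i j" using U(1) by blast
    then have "x \<in> V (prod_encode (i, j))" by (simp add: V_def)
    then show "x \<in> (\<Union>n. V n)" by blast
  qed
  have "hausdorff_content s (\<Union>i. A i) \<le> (\<Sum>n. ennreal (diameter (V n) powr s))"
    by (rule hausdorff_content_le_suminf[OF cov]) (auto simp: V_def U(2) split: prod.splits)
  also have "\<dots> = (\<Sum>i. \<Sum>j. ennreal (diameter (U i j) powr s))"
    unfolding V_def case_prod_unfold
    by (rule suminf_ennreal_2dimen[where f = "\<lambda>p. ennreal (diameter (U (fst p) (snd p)) powr s)"])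
      (simp only: fst_conv snd_conv)
  also have "\<dots> \<le> (\<Sum>i. hausdorff_content s (A i) + ennreal (e * (1/2) ^ Suc i))"
    by (intro suminf_le U) auto
  also have "\<dots> = (\<Sum>i. hausdorff_content s (A i)) + (\<Sum>i. ennreal (e * (1/2) ^ Suc i))"
    by (intro suminf_add[symmetric]) auto
  also have "(\<Sum>i. ennreal (e * (1/2) ^ Suc i)) = ennreal e"
    using sums_mult[OF power_half_series, of e] e
    by (intro suminf_ennreal_eq) auto
  finally show "hausdorff_content s (\<Union>i. A i) \<le> (\<Sum>i. hausdorff_content s (A i)) + ennreal e" .
qed

lemma hausdorff_content_Un_le:
  "hausdorff_content s (A \<union> B) \<le> hausdorff_content s A + hausdorff_content s B"
proof -
  define C where "C = (\<lambda>i::nat. if i = 0 then A else if i = 1 then B else {})"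
  have "A \<union> B = (\<Union>i. C i)"
    by (auto simp: C_def split: if_splits)
  then have "hausdorff_content s (A \<union> B) \<le> (\<Sum>i. hausdorff_content s (C i))"
    using hausdorff_content_UN_le by metis
  also have "\<dots> = (\<Sum>i\<in>{0,1}. hausdorff_content s (C i))"
    by (rule suminf_finite) (auto simp: C_def)
  finally show ?thesis by (simp add: C_def)
qed

lemma hausdorff_content_finite_UN_le:
  assumes "finite I" "\<And>i. i \<in> I \<Longrightarrow> hausdorff_content s (A i) \<le> ennreal y" "0 \<le> y"
  shows "hausdorff_content s (\<Union>i\<in>I. A i) \<le> ennreal (real (card I) * y)"
  using assms(1,2)
proof (induction I rule: finite_induct)
  case (insert i I)
  have "hausdorff_content s (\<Union>i\<in>insert i I. A i)
      \<le> hausdorff_content s (A i) + hausdorff_content s (\<Union>i\<in>I. A i)"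
    using hausdorff_content_Un_le by simp
  also have "\<dots> \<le> ennreal y + ennreal (real (card I) * y)"
    by (intro add_mono insert) (use insert in auto)
  also have "\<dots> = ennreal (real (card (insert i I)) * y)"
    using insert assms(3) by (simp add: algebra_simps flip: ennreal_plus)
  finally show ?case .
qed auto

lemma hausdorff_content_UN_eq_0:
  fixes A :: "nat \<Rightarrow> 'a::metric_space set"
  assumes "\<And>i. hausdorff_content s (A i) = 0"
  shows "hausdorff_content s (\<Union>i. A i) = 0"
  using hausdorff_content_UN_le[of s A] assms by simp

lemma hausdorff_measure_eq_0:
  assumes "hausdorff_content s A = 0" "0 < s"
  shows "hausdorff_measure s A = 0"
proof -
  have *: "hausdorff_pre s \<delta> A \<le> 0 + ennreal e" if "0 < \<delta>" "0 < e" for \<delta> e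
  proof -
    \<comment> \<open>With this cap, one set of diameter above \<open>\<delta>\<close> would
      outweigh the whole sum, so the cover found below is admissible for
      \<open>hausdorff_pre\<close>.\<close>
    define e' where "e' = min e (\<delta> powr s)"
    have e': "0 < e'" using that by (simp add: e'_def)
    have "hausdorff_content s A < ennreal e'" using assms e' by simp
    then obtain U where U: "A \<subseteq> (\<Union>i. U i)" "\<And>i. bounded (U i)"
       "(\<Sum>i. ennreal (diameter (U i) powr s)) < ennreal e'"
      unfolding hausdorff_content_def INF_less_iff by auto
    have "diameter (U i) \<le> \<delta>" for i
    proof (rule ccontr)
      assume "\<not> diameter (U i) \<le> \<delta>"
      then have "ennreal (\<delta> powr s) \<le> ennreal (diameter (U i) powr s)"
        using that assms by (intro ennreal_leI powr_mono2) auto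
      also have "\<dots> \<le> (\<Sum>i. ennreal (diameter (U i) powr s))"
        by (rule ennreal_le_suminf[of "\<lambda>i. ennreal (diameter (U i) powr s)"])
      also have "\<dots> < ennreal e'" by (rule U(3))
      also have "\<dots> \<le> ennreal (\<delta> powr s)" by (rule ennreal_leI) (simp add: e'_def)
      finally show False by simp
    qed
    then have "hausdorff_pre s \<delta> A \<le> (\<Sum>i. ennreal (diameter (U i) powr s))"
      unfolding hausdorff_pre_def by (intro INF_lower) (use U in auto)
    also have "\<dots> \<le> ennreal e"
      using less_imp_le[OF U(3)] by (rule order_trans) (auto simp: e'_def intro: ennreal_leI)
    finally show ?thesis by simp
  qed
  have "hausdorff_pre s \<delta> A \<le> 0" if "0 < \<delta>" for \<delta>
    by (rule ennreal_le_epsilon) (rule *[OF that])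
  then show ?thesis
    unfolding hausdorff_measure_def by (auto intro!: antisym SUP_least)
qed

lemma hausdorff_dim_le:
  assumes "\<And>s. t < s \<Longrightarrow> hausdorff_content s A = 0" "0 \<le> t"
  shows "hausdorff_dim A \<le> ereal t"
proof (rule ereal_le_epsilon2)
  fix e :: real assume "0 < e"
  then show "hausdorff_dim A \<le> ereal t + ereal e"
    unfolding hausdorff_dim_def using assms
    by (auto intro!: INF_lower2[of "t + e"] hausdorff_measure_eq_0)
qed

section \<open>Elementary estimates: square grids and a convergent series\<close>

text \<open>The cells are half-open squares of side \<open>t\<close>, hence the \<open>+ 1\<close>
  for a partial cell in each direction; \<open>2 * t\<close> bounds the sum of the two coordinate
  differences. The pieces are cut out of \<open>A\<close> itself, so they inherit whatever is known
  about its points.\<close>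

lemma grid_partition:
  fixes A :: "complex set"
  assumes "\<And>w. w \<in> A \<Longrightarrow> x \<le> Re w \<and> Re w \<le> x + W \<and> y \<le> Im w \<and> Im w \<le> y + H"
    and "0 < t" "0 \<le> W" "0 \<le> H"
  obtains F where "finite F" "A = \<Union>F" "real (card F) \<le> (W / t + 1) * (H / t + 1)"
    "\<And>B w w'. B \<in> F \<Longrightarrow> w \<in> B \<Longrightarrow> w' \<in> B \<Longrightarrow> dist w w' \<le> 2 * t"
proof
  define m where "m = nat \<lfloor>W / t\<rfloor>"
  define n where "n = nat \<lfloor>H / t\<rfloor>"
  define g where "g = (\<lambda>w. (nat \<lfloor>(Re w - x) / t\<rfloor>, nat \<lfloor>(Im w - y) / t\<rfloor>))"
  define F where "F = (\<lambda>p. {w \<in> A. g w = p}) ` ({..m} \<times> {..n})"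
  show "finite F" by (simp add: F_def)
  have "g w \<in> {..m} \<times> {..n}" if "w \<in> A" for w
    using assms(1)[OF that] assms(2)
    by (auto simp: g_def m_def n_def intro!: nat_mono floor_mono divide_right_mono)
  then show "A = \<Union>F" by (auto simp: F_def)
  have "real (card F) \<le> real (card ({..m} \<times> {..n}))"
    unfolding F_def by (intro of_nat_mono card_image_le) auto
  also have "\<dots> = (real m + 1) * (real n + 1)" by (simp add: algebra_simps)
  also have "\<dots> \<le> (W / t + 1) * (H / t + 1)"
    using assms(2-4) by (intro mult_mono add_mono) (auto simp: m_def n_def)
  finally show "real (card F) \<le> (W / t + 1) * (H / t + 1)" .
  have aux: "\<bar>p - q\<bar> \<le> t" if "nat \<lfloor>p / t\<rfloor> = nat \<lfloor>q / t\<rfloor>" "0 \<le> p" "0 \<le> q" for p q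
  proof -
    have "\<lfloor>p / t\<rfloor> = \<lfloor>q / t\<rfloor>" using that assms(2) by (simp add: nat_eq_iff2)
    then have "\<bar>p / t - q / t\<bar> < 1" by linarith
    then show ?thesis using assms(2) by (simp add: field_simps flip: diff_divide_distrib)
  qed
  fix B w w' assume "B \<in> F" "w \<in> B" "w' \<in> B"
  then have "g w = g w'" "w \<in> A" "w' \<in> A" by (auto simp: F_def)
  then have "\<bar>Re w - Re w'\<bar> \<le> t" "\<bar>Im w - Im w'\<bar> \<le> t"
    using aux[of "Re w - x" "Re w' - x"] aux[of "Im w - y" "Im w' - y"] assms(1)
    by (auto simp: g_def)
  then show "dist w w' \<le> 2 * t"
    using cmod_le[of "w - w'"] by (simp add: dist_norm)
qed

text \<open>Mean value theorem with a decreasing derivative; this makes the series below comparable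
  to a telescoping one.\<close>

lemma powr_diff_ge_derivative:
  fixes x e :: real
  assumes "0 < x" "0 < e"
  shows "e * (x + 1) powr (- (1 + e)) \<le> x powr (- e) - (x + 1) powr (- e)"
proof -
  have "((\<lambda>x. x powr (- e)) has_real_derivative - e * y powr (- e - 1)) (at y)" if "x \<le> y" for y
    using assms that by (auto intro!: derivative_eq_intros)
  from MVT2[of x "x + 1" "\<lambda>x. x powr (- e)" "\<lambda>y. - e * y powr (- e - 1)", OF _ this]
  obtain z where z: "x < z" "z < x + 1"
    "(x + 1) powr (- e) - x powr (- e) = - e * z powr (- e - 1)"
    by auto
  have "(x + 1) powr (- e - 1) \<le> z powr (- e - 1)"
    using z assms by (intro powr_mono2') auto
  then have "e * (x + 1) powr (- e - 1) \<le> e * z powr (- e - 1)"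
    using assms by (intro mult_left_mono) auto
  moreover have "- (1 + e) = - e - 1" by simp
  ultimately show ?thesis using z(3) by (simp only:)
qed

text \<open>The maximum is the lower bound for the modulus on the branch of index \<open>k\<close>.
  From \<open>c \<le> \<alpha>\<close> it follows that \<open>\<alpha> + k + 1\<close> is at most
  \<open>2 + 1 / c\<close> times this maximum, and then the sum of the differences of
  \<open>(\<alpha> + k) powr (- e)\<close> telescopes.\<close>

lemma suminf_max_powr_le:
  fixes c e \<alpha> :: real
  assumes "0 < c" "c \<le> \<alpha>" "0 < e" "0 \<le> Y"
  shows "(\<Sum>k. ennreal (Y * max \<alpha> (real k) powr (- (1 + e))))
     \<le> ennreal (Y * ((2 + 1 / c) powr (1 + e) / e * \<alpha> powr (- e)))"
proof (rule suminf_le_const)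
  define C where "C = (2 + 1 / c) powr (1 + e) / e"
  have C: "0 \<le> C" using assms by (simp add: C_def)
  have *: "max \<alpha> (real k) powr (- (1 + e)) \<le> C * ((\<alpha> + k) powr (- e) - (\<alpha> + Suc k) powr (- e))" for k
  proof -
    have "1 \<le> (1 / c) * max \<alpha> (real k)" using assms by (simp add: field_simps)
    then have le: "\<alpha> + k + 1 \<le> (2 + 1 / c) * max \<alpha> (real k)"
      unfolding distrib_right by linarith
    have pos: "0 < 2 + 1 / c" "0 < max \<alpha> (real k)" using assms by (auto simp: add_pos_pos)
    have "((2 + 1 / c) * max \<alpha> (real k)) powr (- (1 + e)) \<le> (\<alpha> + k + 1) powr (- (1 + e))"
      using assms le by (intro powr_mono2') auto
    then have "(2 + 1 / c) powr (1 + e) * ((2 + 1 / c) powr (- (1 + e)) * max \<alpha> (real k) powr (- (1 + e)))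
        \<le> (2 + 1 / c) powr (1 + e) * (\<alpha> + k + 1) powr (- (1 + e))"
      using pos by (intro mult_left_mono) (auto simp: powr_mult)
    moreover have "(2 + 1 / c) powr (1 + e) * (2 + 1 / c) powr (- (1 + e)) = 1"
      using pos by (subst powr_add[symmetric]) simp
    ultimately have "max \<alpha> (real k) powr (- (1 + e)) \<le> (2 + 1 / c) powr (1 + e) * (\<alpha> + k + 1) powr (- (1 + e))"
      unfolding mult.assoc[symmetric] by simp
    also have "\<dots> = C * (e * (\<alpha> + k + 1) powr (- (1 + e)))" using assms by (simp add: C_def)
    also have "\<dots> \<le> C * ((\<alpha> + k) powr (- e) - (\<alpha> + k + 1) powr (- e))"
      using assms C by (intro mult_left_mono powr_diff_ge_derivative) auto
    finally show ?thesis by (simp add: add_ac)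
  qed
  have "(\<Sum>k<n. max \<alpha> (real k) powr (- (1 + e))) \<le> C * (\<alpha> powr (- e) - (\<alpha> + n) powr (- e))" for n
  proof (induction n)
    case (Suc n)
    then show ?case using *[of n] by (simp add: algebra_simps)
  qed simp
  moreover have "C * (\<alpha> powr (- e) - (\<alpha> + real n) powr (- e)) \<le> C * \<alpha> powr (- e)" for n
    using C by (intro mult_left_mono) auto
  ultimately have "(\<Sum>k<n. max \<alpha> (real k) powr (- (1 + e))) \<le> C * \<alpha> powr (- e)" for n
    using order_trans by blast
  then have "Y * (\<Sum>k<n. max \<alpha> (real k) powr (- (1 + e))) \<le> Y * (C * \<alpha> powr (- e))" for n
    using assms by (intro mult_left_mono) auto
  then show "(\<Sum>k<n. ennreal (Y * max \<alpha> (real k) powr (- (1 + e))))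
     \<le> ennreal (Y * ((2 + 1 / c) powr (1 + e) / e * \<alpha> powr (- e)))" for n
    using assms by (simp add: sum_ennreal sum_distrib_left C_def ennreal_leI)
qed auto

section \<open>Branches of the logarithm on small pieces\<close>

text \<open>On this disc \<open>Re z \<ge> 1/2\<close>, so the derivative \<open>inverse z\<close>
  has modulus at most 2.\<close>

lemma Ln_dist_le:
  assumes "w \<in> cball 1 (1/2)" "w' \<in> cball 1 (1/2)"
  shows "cmod (Ln w - Ln w') \<le> 2 * cmod (w - w')"
proof (rule field_differentiable_bound[OF convex_cball _ _ assms(1,2)])
  fix z :: complex assume z: "z \<in> cball 1 (1/2)"
  have "1/2 \<le> Re z" using z abs_Re_le_cmod[of "1 - z"] by (auto simp: dist_norm)
  then have nz: "z \<notin> \<real>\<^sub>\<le>\<^sub>0" "z \<noteq> 0" by (auto simp: complex_nonpos_Reals_iff)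
  show "(Ln has_field_derivative inverse z) (at z within cball 1 (1/2))"
    using nz by (intro has_field_derivative_Ln has_field_derivative_at_within)
  have "1/2 \<le> cmod z" using \<open>1/2 \<le> Re z\<close> complex_Re_le_cmod[of z] by linarith
  then show "cmod (inverse z) \<le> 2" using le_imp_inverse_le[of "1/2" "cmod z"] by (simp add: norm_inverse)
qed

text \<open>\<open>Q k\<close> is the translate of \<open>Q 0\<close> by \<open>2 \<pi> i k\<close>; choosing the base point of \<open>Q 0\<close> with
  \<open>\<bar>Im v\<bar> \<le> \<pi>\<close> gives the last property.\<close>
lemma exp_preimage_branches:
  assumes "l \<noteq> 0" "\<And>w. w \<in> P \<Longrightarrow> r \<le> cmod w" "0 < r" "2 * d \<le> r"
    and "\<And>w w'. w \<in> P \<Longrightarrow> w' \<in> P \<Longrightarrow> dist w w' \<le> d"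
  obtains Q :: "int \<Rightarrow> complex set" where
    "\<And>u. l * exp u \<in> P \<Longrightarrow> \<exists>k. u \<in> Q k"
    "\<And>k u u'. u \<in> Q k \<Longrightarrow> u' \<in> Q k \<Longrightarrow> dist u u' \<le> 2 * d / r"
    "\<And>k u. u \<in> Q k \<Longrightarrow> \<bar>real_of_int k\<bar> \<le> cmod u"
proof (cases "P = {}")
  case True
  then show ?thesis using that[of "\<lambda>_. {}"] by auto
next
  case False
  then obtain w0 where w0: "w0 \<in> P" by blast
  then have w0r: "r \<le> cmod w0" and w0nz: "w0 \<noteq> 0" using assms by force+
  have d: "0 \<le> d" using assms(5)[OF w0 w0] by simp
  define v0 where "v0 = Ln (w0 / l)"
  define Q where "Q = (\<lambda>k::int. (\<lambda>w. v0 + Ln (w / w0) + of_int k * (of_real (2 * pi) * \<i>)) ` P)"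
  have v0: "l * exp v0 = w0" "\<bar>Im v0\<bar> \<le> pi"
    using assms(1) w0nz Im_Ln_le_pi[of "w0 / l"] mpi_less_Im_Ln[of "w0 / l"] by (auto simp: v0_def)
  \<comment> \<open>Dividing by \<open>w0\<close> moves the piece into the disc of
    \<open>Ln_dist_le\<close>; this is what \<open>2 * d \<le> r\<close> provides.\<close>
  have in_ball: "w / w0 \<in> cball 1 (1/2)" if "w \<in> P" for w
  proof -
    have "cmod (w0 - w) \<le> cmod w0 / 2" using assms(4) assms(5)[OF w0 that] w0r by (simp add: dist_norm)
    then show ?thesis using w0nz
      by (simp add: dist_norm divide_simps norm_divide flip: diff_divide_distrib add: diff_divide_eq_iff)
  qed
  have Ln_dist: "cmod (Ln (w / w0) - Ln (w' / w0)) \<le> 2 * d / r" if "w \<in> P" "w' \<in> P" for w w'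
  proof -
    have "cmod (Ln (w / w0) - Ln (w' / w0)) \<le> 2 * cmod (w / w0 - w' / w0)"
      using in_ball that by (intro Ln_dist_le)
    also have "\<dots> = 2 * (dist w w' / cmod w0)" by (simp add: dist_norm norm_divide flip: diff_divide_distrib)
    also have "\<dots> \<le> 2 * (d / r)"
      using assms(3) w0r assms(5)[OF that] d by (intro mult_left_mono frac_le) auto
    finally show ?thesis by simp
  qed
  show ?thesis
  proof (rule that[of Q])
    fix u assume u: "l * exp u \<in> P"
    have "exp (v0 + Ln (l * exp u / w0)) = exp u"
      using v0(1) w0nz assms(1) by (auto simp: exp_add field_simps)
    then obtain k :: int where "u = v0 + Ln (l * exp u / w0) + of_int (2 * k) * (of_real pi * \<i>)"
      using exp_eq[of u "v0 + Ln (l * exp u / w0)"] by (auto simp: mult_ac)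
    then have "u \<in> Q k" unfolding Q_def using u by (intro image_eqI[of _ _ "l * exp u"]) (auto simp: mult_ac)
    then show "\<exists>k. u \<in> Q k" ..
  next
    fix k u u' assume "u \<in> Q k" "u' \<in> Q k"
    then show "dist u u' \<le> 2 * d / r"
      unfolding Q_def dist_norm using Ln_dist by auto
  next
    fix k u assume "u \<in> Q k"
    then obtain w where w: "w \<in> P" "u = v0 + Ln (w / w0) + of_int k * (of_real (2 * pi) * \<i>)"
      unfolding Q_def by auto
    have "cmod (Ln (w / w0)) \<le> 2 * d / r" using Ln_dist[OF w(1) w0] w0nz by simp
    also have "\<dots> \<le> 1" using assms by (simp add: field_simps)
    finally have "\<bar>Im (Ln (w / w0))\<bar> \<le> 1" using abs_Im_le_cmod order_trans by blast
    moreover have "Im u = Im v0 + Im (Ln (w / w0)) + k * (2 * pi)" using w(2) by simp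
    ultimately have "\<bar>k * (2 * pi)\<bar> - pi - 1 \<le> \<bar>Im u\<bar>" using v0(2) by linarith
    then have le: "\<bar>real_of_int k\<bar> * (2 * pi) - pi - 1 \<le> \<bar>Im u\<bar>" by (simp add: abs_mult)
    show "\<bar>real_of_int k\<bar> \<le> cmod u"
    \<comment> \<open>For nonzero \<open>k\<close> it suffices that
      \<open>(2 * pi - 1) * \<bar>k\<bar>\<close> is at least \<open>pi + 1\<close>, which holds
      already for \<open>\<bar>k\<bar> = 1\<close> because \<open>pi > 2\<close>.\<close>
    proof (cases "k = 0")
      case False
      then have "1 \<le> \<bar>real_of_int k\<bar>" by linarith
      then have "1 * (2 * pi - 1) \<le> \<bar>real_of_int k\<bar> * (2 * pi - 1)"
        using pi_gt3 by (intro mult_right_mono) auto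
      then have "\<bar>real_of_int k\<bar> \<le> \<bar>Im u\<bar>" using le pi_gt3 by (simp add: algebra_simps)
      then show ?thesis using abs_Im_le_cmod order_trans by blast
    qed simp
  qed
qed

section \<open>Content of pullbacks along orbits with prescribed lower bounds\<close>

text \<open>The bounds \<open>\<alpha>\<close> stand in for \<open>a\<close>, which controls an
  orbit only from some time on; \<open>c\<close> bounds them uniformly, so that the cost of one step
  does not depend on the time.\<close>

locale exp_orbits =
  fixes lam :: "nat \<Rightarrow> complex" and \<alpha> :: "nat \<Rightarrow> real" and c R e :: real
  assumes lam_nonzero: "\<And>n. 1 \<le> n \<Longrightarrow> lam n \<noteq> 0"
    and c_pos: "0 < c" and c_le_1: "c \<le> 1" and c_le: "\<And>i. c \<le> \<alpha> i"
    and R_pos: "0 < R" and e_pos: "0 < e"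
begin

lemma alpha_pos: "0 < \<alpha> i"
  using c_pos c_le[of i] by linarith

text \<open>The lower bounds along the orbit make the sums over branches small, and \<open>R\<close>
  keeps the starting points bounded, which the case \<open>j = 0\<close> of the estimate below
  needs.\<close>

definition pullback :: "nat \<Rightarrow> complex set \<Rightarrow> complex set" where
  "pullback j P = {z. cmod z \<le> R \<and> exp_iter lam j z \<in> P \<and> (\<forall>i\<le>j. \<alpha> i \<le> cmod (exp_iter lam i z))}"

text \<open>One step costs at most \<open>(8 / c + 1)\<^sup>2\<close> squares per branch, a factor 2
  for the two signs of the branch index, and the constant of
  \<open>suminf_max_powr_le\<close>.\<close>

definition step_const :: real where
  "step_const = (8 / c + 1)\<^sup>2 * (2 * ((2 + 1 / c) powr (1 + e) / e))"

text \<open>The product stops before \<open>j\<close> since the modulus at time \<open>j\<close>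
  enters the estimates separately, through the inner radius of the piece.\<close>

definition weight :: "nat \<Rightarrow> real" where
  "weight j = R powr (1 + e) * (step_const ^ j * (\<Prod>i<j. \<alpha> i powr (- e)))"

lemma step_const_pos: "0 < step_const"
proof -
  have "0 < 8 / c + 1" "0 < 2 + 1 / c" using c_pos by (auto simp: add_pos_pos)
  then show ?thesis using e_pos by (simp add: step_const_def)
qed

lemma weight_nonneg: "0 \<le> weight j"
  using step_const_pos by (simp add: weight_def prod_nonneg)

lemma pullback_UN: "pullback j (\<Union>i\<in>I. P i) = (\<Union>i\<in>I. pullback j (P i))"
  by (auto simp: pullback_def)

lemma content_pullback_grid_le:
  assumes "\<And>w. w \<in> A \<Longrightarrow> x \<le> Re w \<and> Re w \<le> x + W \<and> y \<le> Im w \<and> Im w \<le> y + H"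
    and "0 < t" "0 \<le> W" "0 \<le> H" "0 \<le> Y"
    and "\<And>B. \<lbrakk>B \<subseteq> A; \<And>w w'. \<lbrakk>w \<in> B; w' \<in> B\<rbrakk> \<Longrightarrow> dist w w' \<le> 2 * t\<rbrakk>
      \<Longrightarrow> hausdorff_content s (pullback j B) \<le> ennreal Y"
  shows "hausdorff_content s (pullback j A) \<le> ennreal ((W / t + 1) * (H / t + 1) * Y)"
proof -
  obtain F where F: "finite F" "A = \<Union>F" "real (card F) \<le> (W / t + 1) * (H / t + 1)"
    "\<And>B w w'. B \<in> F \<Longrightarrow> w \<in> B \<Longrightarrow> w' \<in> B \<Longrightarrow> dist w w' \<le> 2 * t"
    using grid_partition[OF assms(1-4)] by metis
  have "hausdorff_content s (pullback j B) \<le> ennreal Y" if "B \<in> F" for B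
    using that F by (intro assms(6)) auto
  then have "hausdorff_content s (\<Union>B\<in>F. pullback j B) \<le> ennreal (real (card F) * Y)"
    using F assms(5) by (intro hausdorff_content_finite_UN_le) auto
  moreover have "pullback j A = (\<Union>B\<in>F. pullback j B)"
    using pullback_UN[of j "\<lambda>B. B" F] F(2) by simp
  moreover have "real (card F) * Y \<le> (W / t + 1) * (H / t + 1) * Y"
    using F(3) assms(5) by (intro mult_right_mono)
  ultimately show ?thesis
    by (metis (no_types) ennreal_leI order_trans)
qed

text \<open>Induction on \<open>j\<close> for all pieces at once, with the relative size
  \<open>d / r\<close> as the quantity that a logarithm turns into a diameter. The relevant part of
  branch \<open>k\<close> has diameter at most \<open>2 * d / r\<close> and modulus at least
  \<open>max (\<alpha> j) \<bar>k\<bar>\<close>; the exponent \<open>1 + e\<close> makes the sum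
  over \<open>k\<close> converge.\<close>

lemma content_pullback_le:
  assumes "\<And>w. w \<in> P \<Longrightarrow> r \<le> cmod w" "0 < r" "0 < d" "2 * d \<le> r"
    and "\<And>w w'. w \<in> P \<Longrightarrow> w' \<in> P \<Longrightarrow> dist w w' \<le> d"
  shows "hausdorff_content (1 + e) (pullback j P) \<le> ennreal (weight j * (d / r) powr (1 + e))"
  using assms
proof (induction j arbitrary: P r d)
  case 0
  show ?case
  proof (cases "pullback 0 P = {}")
    case False
    \<comment> \<open>A point of the pullback has modulus between \<open>r\<close> and
      \<open>R\<close>, so \<open>d\<close> is at most \<open>R * (d / r)\<close>; this is the
      source of the factor \<open>R powr (1 + e)\<close> in \<open>weight\<close>.\<close>
    then obtain z where "z \<in> P" "cmod z \<le> R" by (auto simp: pullback_def)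
    then have "r \<le> R" using "0.prems"(1) order_trans by blast
    have bdd: "bounded (pullback 0 P)"
      by (rule bounded_subset[of "cball 0 R"]) (auto simp: pullback_def)
    have "hausdorff_content (1 + e) (pullback 0 P) \<le> ennreal (diameter (pullback 0 P) powr (1 + e))"
      by (rule hausdorff_content_le_diameter[OF bdd])
    also have "\<dots> \<le> ennreal (d powr (1 + e))"
    proof (intro ennreal_leI powr_mono2)
      show "diameter (pullback 0 P) \<le> d"
        using "0.prems" by (intro diameter_le) (auto simp: pullback_def dist_norm)
    qed (use e_pos bdd diameter_ge_0 in auto)
    also have "\<dots> \<le> ennreal ((R * (d / r)) powr (1 + e))"
    proof (intro ennreal_leI powr_mono2)
      show "d \<le> R * (d / r)" using \<open>r \<le> R\<close> "0.prems" by (simp add: field_simps)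
    qed (use e_pos "0.prems" in auto)
    also have "(R * (d / r)) powr (1 + e) = weight 0 * (d / r) powr (1 + e)"
      using R_pos "0.prems" by (subst powr_mult) (auto simp: weight_def)
    finally show ?thesis .
  qed simp
next
  case (Suc j)
  obtain Q :: "int \<Rightarrow> complex set" where Q:
    "\<And>u. lam (Suc j) * exp u \<in> P \<Longrightarrow> \<exists>k. u \<in> Q k"
    "\<And>k u u'. u \<in> Q k \<Longrightarrow> u' \<in> Q k \<Longrightarrow> dist u u' \<le> 2 * d / r"
    "\<And>k u. u \<in> Q k \<Longrightarrow> \<bar>real_of_int k\<bar> \<le> cmod u"
    using exp_preimage_branches[of "lam (Suc j)" P r d] lam_nonzero[of "Suc j"] Suc.prems
    by (metis le_add1 plus_1_eq_Suc)
  define rk where "rk = (\<lambda>k::int. max (\<alpha> j) \<bar>real_of_int k\<bar>)"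
  \<comment> \<open>Nothing of interest is lost: orbits counted by \<open>pullback j\<close> have
    modulus at least \<open>\<alpha> j\<close> at time \<open>j\<close>, and all of
    \<open>Q k\<close> has modulus at least \<open>\<bar>k\<bar>\<close>.\<close>
  define Q' where "Q' = (\<lambda>k. {u \<in> Q k. rk k \<le> cmod u})"
  define D where "D = 2 * d / r"
  have D: "0 < D" "D \<le> 1" using Suc.prems by (auto simp: D_def)
  define Y where "Y = weight j * (d / r) powr (1 + e)"
  have Y: "0 \<le> Y" using weight_nonneg by (simp add: Y_def)
  have rk: "0 < rk k" "c \<le> rk k" for k
    using alpha_pos[of j] c_le[of j] by (auto simp: rk_def)
  have branch: "hausdorff_content (1 + e) (pullback j (Q' k))
      \<le> ennreal ((8 / c + 1)\<^sup>2 * Y * rk k powr (- (1 + e)))" for k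
  proof (cases "Q' k = {}")
    case True
    then show ?thesis by (simp add: pullback_def)
  next
    case False
    then obtain u0 where u0: "u0 \<in> Q' k" by blast
    \<comment> \<open>Side \<open>c * D / 4\<close> gives pieces of diameter at most
      \<open>c * D / 2\<close>. As \<open>D \<le> 1\<close> and \<open>c \<le> rk k\<close>, they
      meet the smallness condition of the induction hypothesis even when the branch itself does not.
      The square of side \<open>2 * D\<close> around \<open>u0\<close> contains the branch.\<close>
    have "hausdorff_content (1 + e) (pullback j (Q' k))
        \<le> ennreal ((2 * D / (c * D / 4) + 1) * (2 * D / (c * D / 4) + 1) * (Y * rk k powr (- (1 + e))))"
    proof (rule content_pullback_grid_le)
      fix u assume "u \<in> Q' k"
      then have "cmod (u - u0) \<le> D" using Q(2)[of u k u0] u0 by (auto simp: Q'_def D_def dist_norm)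
      then have "\<bar>Re u - Re u0\<bar> \<le> D" "\<bar>Im u - Im u0\<bar> \<le> D"
        using abs_Re_le_cmod[of "u - u0"] abs_Im_le_cmod[of "u - u0"] by auto
      then show "Re u0 - D \<le> Re u \<and> Re u \<le> Re u0 - D + 2 * D \<and> Im u0 - D \<le> Im u \<and> Im u \<le> Im u0 - D + 2 * D"
        by linarith
    next
      fix B assume B: "B \<subseteq> Q' k" "\<And>w w'. \<lbrakk>w \<in> B; w' \<in> B\<rbrakk> \<Longrightarrow> dist w w' \<le> 2 * (c * D / 4)"
      have "2 * (2 * (c * D / 4)) \<le> c" using D c_pos by simp
      then have "2 * (2 * (c * D / 4)) \<le> rk k" using rk(2)[of k] by (rule order_trans)
      then have "hausdorff_content (1 + e) (pullback j B)
          \<le> ennreal (weight j * (2 * (c * D / 4) / rk k) powr (1 + e))"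
        using B D c_pos rk[of k] by (intro Suc.IH) (auto simp only: Q'_def mult_pos_pos divide_pos_pos)
      also have "\<dots> \<le> ennreal (weight j * ((d / r) * inverse (rk k)) powr (1 + e))"
      proof (intro ennreal_leI mult_left_mono powr_mono2 weight_nonneg)
        have "2 * (c * D / 4) / rk k = c * ((d / r) * inverse (rk k))"
          by (simp add: D_def field_simps)
        also have "\<dots> \<le> 1 * ((d / r) * inverse (rk k))"
          using c_le_1 Suc.prems rk[of k] by (intro mult_right_mono) auto
        finally show "2 * (c * D / 4) / rk k \<le> (d / r) * inverse (rk k)" by simp
      qed (use e_pos c_pos D rk[of k] in auto)
      also have "weight j * ((d / r) * inverse (rk k)) powr (1 + e) = Y * rk k powr (- (1 + e))"
        using Suc.prems rk[of k] unfolding Y_def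
        by (subst powr_mult) (auto simp only: powr_minus inverse_powr mult.assoc)
      finally show "hausdorff_content (1 + e) (pullback j B) \<le> ennreal (Y * rk k powr (- (1 + e)))" .
    qed (use D c_pos Y in auto)
    moreover have "2 * D / (c * D / 4) = 8 / c" using D by (simp add: field_simps)
    ultimately show ?thesis by (simp only: power2_eq_square mult.assoc)
  qed
  define T where "T = (8 / c + 1)\<^sup>2 * Y * ((2 + 1 / c) powr (1 + e) / e * \<alpha> j powr (- e))"
  have T: "0 \<le> T" using Y e_pos by (simp add: T_def)
  \<comment> \<open>Used for \<open>f = int\<close> and for its negative; counting
    \<open>k = 0\<close> twice is harmless.\<close>
  have half: "hausdorff_content (1 + e) (\<Union>n::nat. pullback j (Q' (f n))) \<le> ennreal T"
    if "\<And>n. \<bar>f n\<bar> = int n" for f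
  proof -
    have rk_f: "rk (f n) = max (\<alpha> j) (real n)" for n
      using that[of n] by (simp add: rk_def flip: of_int_abs)
    have "hausdorff_content (1 + e) (\<Union>n::nat. pullback j (Q' (f n)))
        \<le> (\<Sum>n. hausdorff_content (1 + e) (pullback j (Q' (f n))))"
      by (rule hausdorff_content_UN_le)
    also have "\<dots> \<le> (\<Sum>n. ennreal ((8 / c + 1)\<^sup>2 * Y * max (\<alpha> j) (real n) powr (- (1 + e))))"
      using branch[of "f _", unfolded rk_f] by (intro suminf_le summableI) blast
    also have "\<dots> \<le> ennreal T"
      unfolding T_def using c_pos c_le e_pos Y by (intro suminf_max_powr_le) auto
    finally show ?thesis .
  qed
  have "pullback (Suc j) P \<subseteq> (\<Union>n. pullback j (Q' (int n))) \<union> (\<Union>n. pullback j (Q' (- int n)))"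
  proof
    fix z assume z: "z \<in> pullback (Suc j) P"
    then have "lam (Suc j) * exp (exp_iter lam j z) \<in> P" by (simp add: pullback_def)
    then obtain k where k: "exp_iter lam j z \<in> Q k" using Q(1) by blast
    then have "z \<in> pullback j (Q' k)"
      using z Q(3)[OF k] by (auto simp: pullback_def Q'_def rk_def)
    then show "z \<in> (\<Union>n. pullback j (Q' (int n))) \<union> (\<Union>n. pullback j (Q' (- int n)))"
      by (cases k rule: int_cases2) auto
  qed
  then have "hausdorff_content (1 + e) (pullback (Suc j) P)
      \<le> hausdorff_content (1 + e) ((\<Union>n. pullback j (Q' (int n))) \<union> (\<Union>n. pullback j (Q' (- int n))))"
    by (rule hausdorff_content_mono)
  also have "\<dots> \<le> hausdorff_content (1 + e) (\<Union>n. pullback j (Q' (int n)))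
      + hausdorff_content (1 + e) (\<Union>n. pullback j (Q' (- int n)))"
    by (rule hausdorff_content_Un_le)
  also have "\<dots> \<le> ennreal T + ennreal T"
    by (intro add_mono half) auto
  also have "\<dots> = ennreal (2 * T)" using T by (simp flip: ennreal_plus)
  also have "2 * T = weight (Suc j) * (d / r) powr (1 + e)"
    by (simp add: T_def Y_def weight_def step_const_def mult_ac)
  finally show ?case .
qed

text \<open>Each dyadic annulus \<open>r \<le> \<bar>w\<bar> \<le> 2 r\<close> is cut into squares of side \<open>min \<Delta> r / 4\<close>, so the
  bound decays geometrically in the annuli, whether or not the strip is wider than the inner radius.\<close>
lemma content_pullback_strip_le:
  assumes "0 < \<Delta>"
  shows "hausdorff_content (1 + e) (pullback n {w. x \<le> Re w \<and> Re w \<le> x + \<Delta>})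
    \<le> ennreal (weight n * (289 / (1 - 2 powr (- e))) * (\<Delta> / \<alpha> n) powr e)"
proof -
  define r where "r = (\<lambda>m::nat. 2 ^ m * \<alpha> n)"
  define S where "S = (\<lambda>m. {w. x \<le> Re w \<and> Re w \<le> x + \<Delta> \<and> r m \<le> cmod w \<and> cmod w \<le> 2 * r m})"
  define X where "X = 289 * weight n * (\<Delta> / \<alpha> n) powr e"
  have X: "0 \<le> X" using weight_nonneg by (simp add: X_def)
  have r: "0 < r m" for m using alpha_pos by (simp add: r_def)
  have annulus: "hausdorff_content (1 + e) (pullback n (S m)) \<le> ennreal (X * (2 powr (- e)) ^ m)" for m
  proof -
    define q where "q = min \<Delta> (r m)"
    \<comment> \<open>Real parts in \<open>S m\<close> lie in a window of length
      \<open>4 * q\<close> from \<open>x0\<close>: the strip itself if it is narrow, otherwise the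
      full width of the annulus.\<close>
    define x0 where "x0 = (if \<Delta> \<le> r m then x else - 2 * r m)"
    have q: "0 < q" "q \<le> r m" "q \<le> \<Delta>" using assms r by (auto simp: q_def)
    have "hausdorff_content (1 + e) (pullback n (S m))
        \<le> ennreal ((4 * q / (q / 4) + 1) * (4 * r m / (q / 4) + 1) * (weight n * (q / r m) powr (1 + e)))"
    proof (rule content_pullback_grid_le)
      fix w assume w: "w \<in> S m"
      then have "\<bar>Re w\<bar> \<le> 2 * r m" "\<bar>Im w\<bar> \<le> 2 * r m"
        using abs_Re_le_cmod[of w] abs_Im_le_cmod[of w] by (auto simp: S_def)
      then show "x0 \<le> Re w \<and> Re w \<le> x0 + 4 * q \<and> - 2 * r m \<le> Im w \<and> Im w \<le> - 2 * r m + 4 * r m"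
        using w assms by (auto simp: x0_def q_def S_def min_def split: if_splits)
    next
      fix B assume B: "B \<subseteq> S m" "\<And>w w'. \<lbrakk>w \<in> B; w' \<in> B\<rbrakk> \<Longrightarrow> dist w w' \<le> 2 * (q / 4)"
      have "hausdorff_content (1 + e) (pullback n B)
          \<le> ennreal (weight n * (2 * (q / 4) / r m) powr (1 + e))"
        using B q r[of m] by (intro content_pullback_le) (auto simp: S_def)
      also have "\<dots> \<le> ennreal (weight n * (q / r m) powr (1 + e))"
        using q r[of m] e_pos
        by (intro ennreal_leI mult_left_mono powr_mono2 weight_nonneg divide_right_mono) auto
      finally show "hausdorff_content (1 + e) (pullback n B) \<le> ennreal (weight n * (q / r m) powr (1 + e))" .
    qed (use q r[of m] weight_nonneg in auto)
    \<comment> \<open>The first factor equals 17 and the second is at most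
      \<open>17 * (r m / q)\<close> because \<open>q \<le> r m\<close>; hence 289. The number of
      squares then absorbs one power of \<open>q / r m\<close>, leaving the exponent
      \<open>e\<close>.\<close>
    also have "\<dots> \<le> ennreal (289 * (r m / q) * (weight n * (q / r m) powr (1 + e)))"
    proof (intro ennreal_leI mult_right_mono)
      show "(4 * q / (q / 4) + 1) * (4 * r m / (q / 4) + 1) \<le> 289 * (r m / q)"
        using q by (simp add: field_simps)
    qed (use weight_nonneg in auto)
    also have "289 * (r m / q) * (weight n * (q / r m) powr (1 + e)) = 289 * weight n * (q / r m) powr e"
      using q r[of m] by (simp add: powr_add)
    also have "ennreal \<dots> \<le> ennreal (289 * weight n * (\<Delta> / r m) powr e)"
      using q r[of m] e_pos weight_nonneg
      by (intro ennreal_leI mult_left_mono powr_mono2 divide_right_mono) auto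
    also have "289 * weight n * (\<Delta> / r m) powr e = X * (2 powr (- e)) ^ m"
    proof -
      have "(\<Delta> / r m) powr e = (\<Delta> / \<alpha> n) powr e * (2 ^ m) powr (- e)"
        using assms alpha_pos[of n] by (simp add: r_def powr_divide powr_mult powr_minus field_simps)
      also have "(2 ^ m) powr (- e) = (2 powr (- e)) ^ m"
        by (simp add: powr_powr mult.commute flip: powr_realpow)
      finally show ?thesis by (simp add: X_def)
    qed
    finally show ?thesis .
  qed
  have lt1: "2 powr (- e) < 1" using e_pos by (simp add: powr_less_one)
  have "pullback n {w. x \<le> Re w \<and> Re w \<le> x + \<Delta>} \<subseteq> (\<Union>m. pullback n (S m))"
  proof
    fix z assume z: "z \<in> pullback n {w. x \<le> Re w \<and> Re w \<le> x + \<Delta>}"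
    define w where "w = exp_iter lam n z"
    have w: "\<alpha> n \<le> cmod w" using z by (simp add: pullback_def w_def)
    obtain k where "cmod w / \<alpha> n < 2 ^ k" using real_arch_pow[of 2] by auto
    then have "cmod w < r k" using alpha_pos[of n] by (simp add: r_def field_simps)
    then have ex: "\<exists>k. cmod w \<le> 2 * r k" using r[of k] by (intro exI[of _ k]) linarith
    \<comment> \<open>Minimality gives \<open>r m \<le> cmod w\<close> when \<open>m > 0\<close>;
      for \<open>m = 0\<close> the orbit bound \<open>\<alpha> n\<close> does.\<close>
    define m where "m = (LEAST k. cmod w \<le> 2 * r k)"
    have "cmod w \<le> 2 * r m" unfolding m_def using ex by (rule LeastI_ex)
    moreover have "r m \<le> cmod w"
    proof (cases m)
      case 0
      then show ?thesis using w by (simp add: r_def)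
    next
      case (Suc k)
      then have "\<not> cmod w \<le> 2 * r k" using not_less_Least[of k "\<lambda>k. cmod w \<le> 2 * r k"] by (simp add: m_def)
      then show ?thesis using Suc by (simp add: r_def)
    qed
    ultimately have "r m \<le> cmod w" "cmod w \<le> 2 * r m" by auto
    then have "z \<in> pullback n (S m)" using z by (simp add: pullback_def S_def w_def)
    then show "z \<in> (\<Union>m. pullback n (S m))" by blast
  qed
  then have "hausdorff_content (1 + e) (pullback n {w. x \<le> Re w \<and> Re w \<le> x + \<Delta>})
      \<le> hausdorff_content (1 + e) (\<Union>m. pullback n (S m))"
    by (rule hausdorff_content_mono)
  also have "\<dots> \<le> (\<Sum>m. hausdorff_content (1 + e) (pullback n (S m)))"
    by (rule hausdorff_content_UN_le)
  also have "\<dots> \<le> (\<Sum>m. ennreal (X * (2 powr (- e)) ^ m))"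
    by (intro suminf_le summableI annulus)
  also have "\<dots> = ennreal (X * (1 / (1 - 2 powr (- e))))"
    using lt1 X by (intro suminf_ennreal_eq sums_mult geometric_sums) auto
  also have "X * (1 / (1 - 2 powr (- e))) = weight n * (289 / (1 - 2 powr (- e))) * (\<Delta> / \<alpha> n) powr e"
    by (simp add: X_def)
  finally show ?thesis .
qed

end

section \<open>Vanishing content along the lower limit, and the dimension bound\<close>

lemma liminf_zero_obtains_less:
  assumes "liminf (\<lambda>n. ereal (f n)) = 0" "0 < t"
  obtains n where "m \<le> n" "f n < t"
proof (rule ccontr)
  assume "\<not> thesis"
  then have "t \<le> f n" if "m \<le> n" for n
    using that \<open>\<And>n. m \<le> n \<Longrightarrow> f n < t \<Longrightarrow> thesis\<close> not_less by blast
  then have "ereal t \<le> liminf (\<lambda>n. ereal (f n))"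
    by (intro Liminf_bounded) (auto simp: eventually_sequentially)
  then show False using assms by simp
qed

text \<open>For every \<open>n \<ge> N\<close> the condition at time \<open>n + 1\<close> puts the
  set into the pullback of a strip, so its content is below all the resulting bounds; the lower
  limit supplies large \<open>n\<close> at which they are arbitrarily small.\<close>

lemma content_bounded_orbits_eq_0:
  fixes lam :: "nat \<Rightarrow> complex" and a b :: "nat \<Rightarrow> real"
  assumes lam: "\<And>n. 1 \<le> n \<Longrightarrow> lam n \<noteq> 0"
    and ab: "\<And>n. 1 \<le> n \<Longrightarrow> 0 < a n \<and> a n < b n"
    and c: "0 < c" "c \<le> 1" "\<And>n. 1 \<le> n \<Longrightarrow> c \<le> a n"
    and lim: "liminf (\<lambda>n. ereal ((ln (b (n+1) / a (n+1)) / (\<Prod>k=1..n. a k)) powr (1 / real n))) = 0"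
    and R: "0 < R" and e: "0 < e"
  shows "hausdorff_content (1 + e) {z. cmod z \<le> R \<and> (\<forall>i\<le>N. c \<le> cmod (exp_iter lam i z)) \<and>
     (\<forall>i>N. a i \<le> cmod (exp_iter lam i z) \<and> cmod (exp_iter lam i z) \<le> b i)} = 0"
    (is "hausdorff_content _ ?Y = 0")
proof -
  define \<alpha> where "\<alpha> = (\<lambda>i. if i \<le> N then c else a i)"
  interpret exp_orbits lam \<alpha> c R e
    by standard (use assms in \<open>auto simp: \<alpha>_def\<close>)
  define x where "x = (\<lambda>n. ln (b (n+1) / a (n+1)) / (\<Prod>k=1..n. a k))"
  \<comment> \<open>For \<open>n \<ge> N\<close> this is the ratio of the product of
    \<open>\<alpha> 0, ..., \<alpha> n\<close> to that of \<open>a 1, ..., a n\<close>; the leading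
    \<open>c\<close> is \<open>\<alpha> 0\<close>.\<close>
  define \<kappa> where "\<kappa> = c * (\<Prod>k=1..N. c / a k)"
  define M where "M = R powr (1 + e) * (289 / (1 - 2 powr (- e))) * \<kappa> powr (- e)"
  have prod_a: "0 < (\<Prod>k=1..n. a k)" for n using ab by (intro prod_pos) auto
  have \<Delta>: "0 < ln (b (n+1) / a (n+1))" for n using ab[of "n+1"] by simp
  have x: "0 < x n" for n unfolding x_def using prod_a \<Delta> by (intro divide_pos_pos)
  have \<kappa>: "0 < \<kappa>" using c ab by (auto simp: \<kappa>_def intro!: prod_pos mult_pos_pos)
  have M: "0 < M" using R e \<kappa> by (auto simp: M_def powr_less_one intro!: mult_pos_pos divide_pos_pos)
  have prod_\<alpha>: "(\<Prod>i<n. \<alpha> i) * \<alpha> n = \<kappa> * (\<Prod>k=1..n. a k)" if "N \<le> n" for n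
  proof -
    have "(\<Prod>i<n. \<alpha> i) * \<alpha> n = (\<Prod>i\<in>{0..n}. \<alpha> i)"
      by (simp add: atLeast0AtMost flip: lessThan_Suc_atMost)
    also have "\<dots> = \<alpha> 0 * (\<Prod>k=1..n. \<alpha> k)"
      by (simp add: prod.atLeast_Suc_atMost)
    also have "(\<Prod>k=1..n. \<alpha> k) = (\<Prod>k=1..n. a k * (if k \<le> N then c / a k else 1))"
      using ab by (intro prod.cong) (auto simp: \<alpha>_def less_imp_neq[symmetric])
    also have "\<dots> = (\<Prod>k=1..n. a k) * (\<Prod>k=1..n. if k \<le> N then c / a k else 1)"
      by (rule prod.distrib)
    also have "(\<Prod>k=1..n. if k \<le> N then c / a k else 1) = (\<Prod>k=1..N. c / a k)"
      using that by (intro prod.mono_neutral_cong_right) auto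
    finally show ?thesis by (simp add: \<kappa>_def \<alpha>_def)
  qed
  have bound: "hausdorff_content (1 + e) ?Y \<le> ennreal (M * (step_const ^ n * x n powr e))" if "N \<le> n" for n
  proof -
    \<comment> \<open>Taking logarithms in \<open>a \<le> cmod lam * exp (Re w) \<le> b\<close> at
      index \<open>n + 1\<close> gives a strip with left edge \<open>t\<close>.\<close>
    define t where "t = ln (a (n+1) / cmod (lam (n+1)))"
    have l: "0 < cmod (lam (n+1))" using lam[of "n+1"] by simp
    have "?Y \<subseteq> pullback n {w. t \<le> Re w \<and> Re w \<le> t + ln (b (n+1) / a (n+1))}"
    proof
      fix z assume z: "z \<in> ?Y"
      define w where "w = exp_iter lam n z"
      have "a (n+1) \<le> cmod (lam (n+1)) * exp (Re w)" "cmod (lam (n+1)) * exp (Re w) \<le> b (n+1)"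
        using z that by (auto simp: w_def norm_mult dest!: spec[of _ "Suc n"])
      then have "a (n+1) / cmod (lam (n+1)) \<le> exp (Re w)" "exp (Re w) \<le> b (n+1) / cmod (lam (n+1))"
        using l by (auto simp: field_simps)
      then have "t \<le> Re w" "Re w \<le> ln (b (n+1) / cmod (lam (n+1)))"
        using l ab[of "n+1"] by (auto simp: t_def ln_ge_iff intro: ln_le_cancel_iff[THEN iffD2, of _ "exp _", simplified])
      moreover have "ln (b (n+1) / cmod (lam (n+1))) = t + ln (b (n+1) / a (n+1))"
        using l ab[of "n+1"] by (auto simp: t_def ln_div)
      ultimately show "z \<in> pullback n {w. t \<le> Re w \<and> Re w \<le> t + ln (b (n+1) / a (n+1))}"
        using z that unfolding pullback_def by (auto simp: w_def \<alpha>_def)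
    qed
    then have "hausdorff_content (1 + e) ?Y
        \<le> hausdorff_content (1 + e) (pullback n {w. t \<le> Re w \<and> Re w \<le> t + ln (b (n+1) / a (n+1))})"
      by (rule hausdorff_content_mono)
    also have "\<dots> \<le> ennreal (weight n * (289 / (1 - 2 powr (- e))) * (ln (b (n+1) / a (n+1)) / \<alpha> n) powr e)"
      by (rule content_pullback_strip_le[OF \<Delta>])
    also have "weight n * (289 / (1 - 2 powr (- e))) * (ln (b (n+1) / a (n+1)) / \<alpha> n) powr e
        = M * (step_const ^ n * x n powr e)"
    proof -
      have "(\<Prod>i<n. \<alpha> i powr (- e)) * (ln (b (n+1) / a (n+1)) / \<alpha> n) powr e
          = (ln (b (n+1) / a (n+1)) / ((\<Prod>i<n. \<alpha> i) * \<alpha> n)) powr e"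
      proof -
        have "(\<Prod>i<n. \<alpha> i powr (- e)) = (\<Prod>i<n. \<alpha> i) powr (- e)"
          by (intro prod_powr_distrib[symmetric])
        moreover have "0 < (\<Prod>i<n. \<alpha> i)" using alpha_pos by (intro prod_pos) auto
        ultimately show ?thesis using alpha_pos[of n] \<Delta>[of n]
          by (simp add: powr_divide powr_mult powr_minus field_simps)
      qed
      also have "\<dots> = (x n / \<kappa>) powr e"
        unfolding prod_\<alpha>[OF that] x_def by (simp add: field_simps)
      also have "\<dots> = \<kappa> powr (- e) * x n powr e"
        using x[of n] \<kappa> by (simp add: powr_divide powr_minus field_simps)
      finally have *: "(\<Prod>i<n. \<alpha> i powr (- e)) * (ln (b (n+1) / a (n+1)) / \<alpha> n) powr e
          = \<kappa> powr (- e) * x n powr e" .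
      have "weight n * (289 / (1 - 2 powr (- e))) * (ln (b (n+1) / a (n+1)) / \<alpha> n) powr e
        = R powr (1 + e) * (289 / (1 - 2 powr (- e))) * step_const ^ n
          * ((\<Prod>i<n. \<alpha> i powr (- e)) * (ln (b (n+1) / a (n+1)) / \<alpha> n) powr e)"
        by (simp only: weight_def mult_ac)
      then show ?thesis unfolding * M_def by (simp only: mult_ac)
    qed
    finally show ?thesis .
  qed
  \<comment> \<open>Chosen so that \<open>step_const * \<tau> powr e = 1/2\<close>, which beats the
    exponential growth of the bound.\<close>
  define \<tau> where "\<tau> = (1 / (2 * step_const)) powr (1 / e)"
  have \<tau>: "0 < \<tau>" "\<tau> powr e = 1 / (2 * step_const)"
    using step_const_pos e by (auto simp: \<tau>_def powr_powr)
  have "hausdorff_content (1 + e) ?Y \<le> 0 + ennreal \<epsilon>" if "0 < \<epsilon>" for \<epsilon>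
  proof -
    have "(\<lambda>n. M * (1/2) ^ n) \<longlonglongrightarrow> M * 0"
      by (intro tendsto_mult tendsto_const LIMSEQ_power_zero) simp
    then have "eventually (\<lambda>n. M * (1/2) ^ n < \<epsilon>) sequentially"
      using that by (intro order_tendstoD(2)[of _ "M * 0"]) auto
    then obtain m where m: "\<And>n. m \<le> n \<Longrightarrow> M * (1/2) ^ n < \<epsilon>"
      by (auto simp: eventually_sequentially)
    \<comment> \<open>\<open>Suc N\<close> also forces \<open>n > 0\<close>, so that raising to the
      power \<open>n\<close> undoes the exponent \<open>1 / real n\<close>.\<close>
    obtain n where n: "max (Suc N) m \<le> n" "x n powr (1 / real n) < \<tau>"
      using liminf_zero_obtains_less[OF lim \<tau>(1), of "max (Suc N) m"] unfolding x_def by metis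
    have "x n = (x n powr (1 / real n)) powr n"
      using n x[of n] by (simp add: powr_powr)
    also have "\<dots> \<le> \<tau> powr n" using n by (intro powr_mono2) auto
    finally have "x n powr e \<le> (\<tau> powr n) powr e" using x[of n] e by (intro powr_mono2) auto
    also have "\<dots> = (\<tau> powr e) powr n" by (simp add: powr_powr mult.commute)
    also have "\<dots> = (1 / (2 * step_const)) ^ n"
      using step_const_pos by (simp add: \<tau>(2) powr_realpow)
    finally have "step_const ^ n * x n powr e \<le> step_const ^ n * (1 / (2 * step_const)) ^ n"
      using step_const_pos by (intro mult_left_mono) auto
    also have "\<dots> = (1/2) ^ n" using step_const_pos by (simp flip: power_mult_distrib)
    finally have "M * (step_const ^ n * x n powr e) \<le> M * (1/2) ^ n"
      using M by (intro mult_left_mono) auto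
    also have "\<dots> \<le> \<epsilon>" using m[of n] n by simp
    finally have "M * (step_const ^ n * x n powr e) \<le> \<epsilon>" .
    then show ?thesis using bound[of n] n by (auto intro: order_trans ennreal_leI)
  qed
  then have "hausdorff_content (1 + e) ?Y \<le> 0" by (rule ennreal_le_epsilon)
  then show ?thesis by simp
qed

theorem theorem2p1:
  fixes lam :: "nat \<Rightarrow> complex" and a b :: "nat \<Rightarrow> real"
  assumes "\<forall>n\<ge>1. lam n \<noteq> 0"
    and "\<forall>n\<ge>1. 0 < a n \<and> a n < b n"
    and "(INF n \<in> {1..}. a n) > 0"
    and "liminf (\<lambda>n. ereal ((ln (b (n+1) / a (n+1)) / (\<Prod>k=1..n. a k)) powr (1 / real n))) = 0"
  shows "hausdorff_dim (I_set lam a b) \<le> 1"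
proof -
  \<comment> \<open>A single index \<open>m\<close> serves for the radius and for the lower bound on
    the early orbit.\<close>
  define c where "c = (\<lambda>m::nat. min (INF n \<in> {1..}. a n) (1 / real (Suc m)))"
  have c: "0 < c m" "c m \<le> 1" "\<And>n. 1 \<le> n \<Longrightarrow> c m \<le> a n" for m
  proof -
    show "0 < c m" "c m \<le> 1" using assms(3) by (auto simp: c_def min_le_iff_disj)
    fix n :: nat assume "1 \<le> n"
    moreover have "bdd_below (a ` {1..})" using assms(2) by (intro bdd_belowI[of _ 0]) (auto intro: less_imp_le)
    ultimately have "(INF n \<in> {1..}. a n) \<le> a n" by (intro cINF_lower) auto
    then show "c m \<le> a n" by (simp add: c_def)
  qed
  define Y where "Y = (\<lambda>N m. {z. cmod z \<le> real (Suc m) \<and> (\<forall>i\<le>N. c m \<le> cmod (exp_iter lam i z)) \<and>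
     (\<forall>i>N. a i \<le> cmod (exp_iter lam i z) \<and> cmod (exp_iter lam i z) \<le> b i)})"
  \<comment> \<open>The point 0 is set apart because its orbit vanishes at time 0. From any other
    start no iterate vanishes, so the finitely many early moduli have a positive minimum.\<close>
  have sub: "I_set lam a b \<subseteq> {0} \<union> (\<Union>N m. Y N m)"
  proof
    fix z assume z: "z \<in> I_set lam a b"
    then obtain N where N: "\<And>n. N \<le> n \<Longrightarrow> a n \<le> cmod (exp_iter lam n z) \<and> cmod (exp_iter lam n z) \<le> b n"
      by (auto simp: I_set_def eventually_sequentially)
    show "z \<in> {0} \<union> (\<Union>N m. Y N m)"
    proof (cases "z = 0")
      case False
      then have nz: "exp_iter lam i z \<noteq> 0" for i using assms(1) by (cases i) auto
      define \<mu> where "\<mu> = Min ((\<lambda>i. cmod (exp_iter lam i z)) ` {..N})"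
      have \<mu>: "0 < \<mu>" "\<And>i. i \<le> N \<Longrightarrow> \<mu> \<le> cmod (exp_iter lam i z)"
        using nz by (auto simp: \<mu>_def)
      obtain m1 where m1: "1 / real (Suc m1) < \<mu>"
        using reals_Archimedean[OF \<mu>(1)] by (auto simp: inverse_eq_divide)
      obtain m2 where m2: "cmod z \<le> real m2" using real_arch_simple by blast
      define m where "m = max m1 m2"
      have "1 / real (Suc m) \<le> 1 / real (Suc m1)" by (intro divide_left_mono) (auto simp: m_def)
      then have "c m \<le> \<mu>" using m1 by (simp add: c_def)
      then have "z \<in> Y N m" using N \<mu>(2) m2 by (force simp: Y_def m_def)
      then show ?thesis by blast
    qed simp
  qed
  have "hausdorff_content s (I_set lam a b) = 0" if "1 < s" for s
  proof -
    have "hausdorff_content (1 + (s - 1)) (Y N m) = 0" for N m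
      unfolding Y_def using assms that c
      by (intro content_bounded_orbits_eq_0[where b = b]) auto
    then have "hausdorff_content s (\<Union>N m. Y N m) = 0"
      by (intro hausdorff_content_UN_eq_0) simp
    then have "hausdorff_content s ({0} \<union> (\<Union>N m. Y N m)) \<le> 0"
      using hausdorff_content_Un_le[of s "{0}" "\<Union>N m. Y N m"] by simp
    then show ?thesis
      using hausdorff_content_mono[OF sub, of s] by simp
  qed
  then show ?thesis using hausdorff_dim_le[of 1 "I_set lam a b"] by (simp add: one_ereal_def)
qed

end
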